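(* Let $m\geq 4$ and $0\leq k\leq 2m-4$. The map $\overline{\psi}_{2,k}$ is linearly expandable for $\mathfrak{g}_{(m,m-1)}^{4,1}$, i.e. $\mu+\overline{\psi}_{2,k}$ is a Lie bracket (where $\mu$ is the bracket of $\mathfrak{g}_{(m,m-1)}^{4,1}$), if and only if $k=2m-5$ or $k=2m-4$.
   Context: All Lie algebras are finite-dimensional over $\mathbb{C}$. The algebra: for $m\geq 4$, $\mathfrak{g}_{(m,m-1)}^{4,1}$ is the $(2m+2)$-dimensional Lie algebra with Cartan–Maurer equations, in the basis $\omega_1,\dots,\omega_{2m+2}$ of its dual, $$d\omega_1=d\omega_2=0,\quad d\omega_j=\omega_1\wedge\omega_{j-1}\ (3\leq j\leq 2m),\quad d\omega_{2m+1}=\sum_{j=2}^m(-1)^j\omega_j\wedge\omega_{2m+1-j},$$ $$d\omega_{2m+2}=\omega_1\wedge\omega_{2m+1}+\sum_{j=2}^m(-1)^j(m+1-j)\,\omega_j\wedge\omega_{2m+2-j}.$$ Convention: if $X_1,\dots,X_{2m+2}$ is the dual basis and $[X_i,X_j]=\sum_l C_{ij}^lX_l$, then $d\omega_l=\sum_{i<j}C_{ij}^l\,\omega_i\wedge\omega_j$; so e.g. $[X_1,X_i]=X_{i+1}$ for $2\leq i\leq 2m-1$ and $[X_1,X_{2m+1}]=X_{2m+2}$. The map: $\overline{\psi}_{2,k}$ is the alternating bilinear map on $\mathfrak{g}_{(m,m-1)}^{4,1}$ with $\overline{\psi}_{2,k}(X_2,X_j)=-\overline{\psi}_{2,k}(X_j,X_2)=X_{1+j+k}$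 for $3\leq j\leq 2m-1-k$, and $\overline{\psi}_{2,k}(X_l,X_j)=0$ for all other pairs of basis vectors (in particular whenever one of the arguments is $X_{2m+2}$). *)

theory Defs
  imports Complex_Main "HOL-Library.Function_Algebras"
begin

text \<open>The space \<open>\<complex>\<^sup>n\<close>, with coordinates indexed by \<open>1, \<dots>, n\<close>, is the set of functions
  \<open>nat \<Rightarrow> complex\<close> that vanish outside \<open>{1..n}\<close>; addition is the pointwise one of
  \<open>Function_Algebras\<close>.\<close>

type_synonym cvec = "nat \<Rightarrow> complex"

definition scale :: "complex \<Rightarrow> cvec \<Rightarrow> cvec" where
  "scale c v = (\<lambda>i. c * v i)"

definition cspace :: "nat \<Rightarrow> cvec set" where
  "cspace n = {v. \<forall>i. i \<notin> {1..n} \<longrightarrow> v i = 0}"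

definition X :: "nat \<Rightarrow> cvec" where
  "X i = (\<lambda>l. if l = i then 1 else 0)"

lemma vector_space_scale: "vector_space scale"
  by unfold_locales (simp_all add: scale_def fun_eq_iff algebra_simps)

lemma subspace_cspace: "module.subspace scale (cspace n)"
proof -
  interpret vector_space scale by (rule vector_space_scale)
  show ?thesis
    unfolding subspace_def by (simp add: cspace_def scale_def)
qed

definition bilinear_on :: "cvec set \<Rightarrow> (cvec \<Rightarrow> cvec \<Rightarrow> cvec) \<Rightarrow> bool" where
  "bilinear_on V b \<longleftrightarrow>
     (\<forall>x\<in>V. \<forall>y\<in>V. b x y \<in> V) \<and>
     (\<forall>x\<in>V. \<forall>y\<in>V. \<forall>z\<in>V. b (x + y) z = b x z + b y z \<and> b z (x + y) = b z x + b z y) \<and>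
     (\<forall>c. \<forall>x\<in>V. \<forall>y\<in>V. b (scale c x) y = scale c (b x y) \<and> b x (scale c y) = scale c (b x y))"

definition lie_bracket_on :: "cvec set \<Rightarrow> (cvec \<Rightarrow> cvec \<Rightarrow> cvec) \<Rightarrow> bool" where
  "lie_bracket_on V b \<longleftrightarrow>
     bilinear_on V b \<and>
     (\<forall>x\<in>V. b x x = 0) \<and>
     (\<forall>x\<in>V. \<forall>y\<in>V. \<forall>z\<in>V. b x (b y z) + b y (b z x) + b z (b x y) = 0)"

definition linearly_expandable_on ::
  "cvec set \<Rightarrow> (cvec \<Rightarrow> cvec \<Rightarrow> cvec) \<Rightarrow> (cvec \<Rightarrow> cvec \<Rightarrow> cvec) \<Rightarrow> bool" where
  "linearly_expandable_on V b \<psi> \<longleftrightarrow> lie_bracket_on V (\<lambda>x y. b x y + \<psi> x y)"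

definition \<omega> :: "nat \<Rightarrow> cvec \<Rightarrow> complex" where
  "\<omega> i v = v i"

definition wedge :: "(cvec \<Rightarrow> complex) \<Rightarrow> (cvec \<Rightarrow> complex) \<Rightarrow> cvec \<Rightarrow> cvec \<Rightarrow> complex" where
  "wedge \<alpha> \<beta> u v = \<alpha> u * \<beta> v - \<alpha> v * \<beta> u"

text \<open>The Cartan--Maurer equations: \<open>d\<omega> m l\<close> is the 2-form that they assign to \<open>\<omega> l\<close>.\<close>

definition d\<omega> :: "nat \<Rightarrow> nat \<Rightarrow> cvec \<Rightarrow> cvec \<Rightarrow> complex" where
  "d\<omega> m l u v =
     (if 3 \<le> l \<and> l \<le> 2 * m then wedge (\<omega> 1) (\<omega> (l - 1)) u v
      else if l = 2 * m + 1 then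
        (\<Sum>j=2..m. (-1) ^ j * wedge (\<omega> j) (\<omega> (2 * m + 1 - j)) u v)
      else if l = 2 * m + 2 then
        wedge (\<omega> 1) (\<omega> (2 * m + 1)) u v +
        (\<Sum>j=2..m. (-1) ^ j * of_nat (m + 1 - j) * wedge (\<omega> j) (\<omega> (2 * m + 2 - j)) u v)
      else 0)"

text \<open>The bracket of \<open>\<gg>\<^bsub>(m,m-1)\<^esub>\<^sup>4\<^sup>,\<^sup>1\<close> on \<open>cspace (2 * m + 2)\<close>. With the sign convention
  \<open>d\<omega>\<^sub>l = \<Sum>\<^bsub>i<j\<^esub> C\<^bsub>ij\<^esub>\<^sup>l \<omega>\<^sub>i \<and> \<omega>\<^sub>j\<close>, the coefficient of \<open>X l\<close> in \<open>[u, v]\<close> is \<open>d\<omega>\<^sub>l(u, v)\<close>.\<close>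

definition bracket :: "nat \<Rightarrow> cvec \<Rightarrow> cvec \<Rightarrow> cvec" where
  "bracket m u v = (\<lambda>l. d\<omega> m l u v)"

definition bilinear_ext :: "nat \<Rightarrow> (nat \<Rightarrow> nat \<Rightarrow> cvec) \<Rightarrow> cvec \<Rightarrow> cvec \<Rightarrow> cvec" where
  "bilinear_ext n B u v = (\<Sum>i=1..n. \<Sum>j=1..n. scale (u i * v j) (B i j))"

text \<open>The subtraction \<open>2 * m - 1 - k\<close> does not truncate in the range \<open>k \<le> 2 * m - 4\<close>, \<open>m \<ge> 4\<close>.\<close>

definition psi_basis :: "nat \<Rightarrow> nat \<Rightarrow> nat \<Rightarrow> nat \<Rightarrow> cvec" where
  "psi_basis m k i j =
     (if i = 2 \<and> 3 \<le> j \<and> j \<le> 2 * m - 1 - k then X (1 + j + k)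
      else if j = 2 \<and> 3 \<le> i \<and> i \<le> 2 * m - 1 - k then scale (-1) (X (1 + i + k))
      else 0)"

definition psi_bar :: "nat \<Rightarrow> nat \<Rightarrow> cvec \<Rightarrow> cvec \<Rightarrow> cvec" where
  "psi_bar m k = bilinear_ext (2 * m + 2) (psi_basis m k)"

lemma bilinear_ext_X:
  assumes "i \<in> {1..n}" "j \<in> {1..n}"
  shows "bilinear_ext n B (X i) (X j) = B i j"
proof -
  have "scale (X i a * X j b) (B a b) = (if b = j then if a = i then B a b else 0 else 0)" for a b
    by (auto simp: X_def scale_def fun_eq_iff)
  then show ?thesis
    using assms by (simp add: bilinear_ext_def sum.delta)
qed

lemma bracket_X1:
  assumes "m \<ge> 4" "2 \<le> i" "i \<le> 2 * m - 1 \<or> i = 2 * m + 1"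
  shows "bracket m (X 1) (X i) = X (i + 1)"
  using assms by (auto simp: bracket_def d\<omega>_def wedge_def \<omega>_def X_def fun_eq_iff intro!: sum.neutral)

end

theory Submission
  imports Defs
begin

text \<open>For \<open>k \<le> 2 * m - 6\<close> the Jacobi identity fails on \<open>X 2\<close>, \<open>X 3\<close>, \<open>X (2 * m - 2 - k)\<close>: the
  \<open>X (2 * m + 2)\<close>-coefficient of the cyclic sum is \<open>k + 1\<close> for even \<open>k\<close> and \<open>2 * m - 5 - k\<close> for
  odd \<open>k\<close>. For the two largest values of \<open>k\<close> the map takes values in the span of \<open>X (2 * m - 1)\<close> and
  \<open>X (2 * m)\<close>, which pair in the last two coordinates only with \<open>X 2\<close> and \<open>X 3\<close>; all its
  contributions to the Jacobi identity then cancel by antisymmetry.\<close>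

section \<open>The map in coordinates\<close>

lemma sum_fun_apply: "(\<Sum>i\<in>A. f i) x = (\<Sum>i\<in>A. f i x)"
  for f :: "'i \<Rightarrow> 'a \<Rightarrow> 'b::comm_monoid_add"
  by (induction A rule: infinite_finite_induct) auto

text \<open>Coordinate \<open>l\<close> is reached only from the index pair 2 and
  \<open>l - 1 - k\<close>, in either order, so the double sum collapses to two terms. The range of
  \<open>j\<close> in \<open>psi_basis\<close> turns into the range of \<open>l\<close>.\<close>

lemma psi_bar_apply:
  assumes "k \<le> 2 * m - 4" "m \<ge> 4"
  shows "psi_bar m k x y l =
    (if k + 4 \<le> l \<and> l \<le> 2 * m then x 2 * y (l - 1 - k) - y 2 * x (l - 1 - k) else 0)"
proof -
  let ?P = "k + 4 \<le> l \<and> l \<le> 2 * m" and ?N = "{1..2 * m + 2}" and ?q = "l - 1 - k"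
  define c where "c = (if ?P then x 2 * y ?q else 0)"
  define d where "d = (if ?P then y 2 * x ?q else 0)"
  have basis: "x i * y j * psi_basis m k i j l =
    (if i = 2 then if j = ?q then c else 0 else 0) - (if i = ?q then if j = 2 then d else 0 else 0)" for i j
  proof -
    have image: "3 \<le> j \<and> j \<le> 2 * m - 1 - k \<and> l = 1 + j + k \<longleftrightarrow> ?P \<and> j = ?q" for j
      using assms by linarith
    have "psi_basis m k i j l =
        (if i = 2 \<and> 3 \<le> j \<and> j \<le> 2 * m - 1 - k \<and> l = 1 + j + k then 1 else 0)
        - (if j = 2 \<and> 3 \<le> i \<and> i \<le> 2 * m - 1 - k \<and> l = 1 + i + k then 1 else 0)"
      by (simp add: psi_basis_def X_def scale_def)
    then show ?thesis
      unfolding image by (simp add: c_def d_def)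
  qed
  \<comment> \<open>The alternative \<open>e = 0\<close> covers \<open>l\<close> out of range, where
    \<open>?q\<close> may fall outside \<open>?N\<close>.\<close>
  have delta: "(\<Sum>i\<in>?N. \<Sum>j\<in>?N. if i = p then if j = q then e else 0 else 0) = e"
    if "p \<in> ?N \<and> q \<in> ?N \<or> e = 0" for p q and e :: complex
  proof -
    have "(\<Sum>j\<in>?N. if i = p then if j = q then e else 0 else 0)
        = (if i = p then if q \<in> ?N then e else 0 else 0)" for i
      by (cases "i = p") simp_all
    with that show ?thesis
      by auto
  qed
  have q: "?q \<in> ?N" if ?P
    using that by auto
  have "psi_bar m k x y l = (\<Sum>i\<in>?N. \<Sum>j\<in>?N. x i * y j * psi_basis m k i j l)"
    by (simp add: psi_bar_def bilinear_ext_def sum_fun_apply scale_def)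
  also have "\<dots> = c - d"
  proof -
    have "2 \<in> ?N \<and> ?q \<in> ?N \<or> c = 0" "?q \<in> ?N \<and> 2 \<in> ?N \<or> d = 0"
      using q by (auto simp: c_def d_def)
    then show ?thesis
      unfolding basis sum_subtractf by (simp only: delta)
  qed
  finally show ?thesis
    by (simp add: c_def d_def)
qed

section \<open>The Cartan-Maurer sums as convolutions\<close>

text \<open>The sums over \<open>j = 2, \<dots>, m\<close> of wedge products in the Cartan--Maurer equations are rewritten
  as sums over all pairs of indices from \<open>2\<close> on with fixed total, since these are stable under
  \<open>a \<mapsto> n - a\<close> and under the shift by \<open>X 1\<close>.\<close>

definition conv :: "(nat \<Rightarrow> complex) \<Rightarrow> nat \<Rightarrow> cvec \<Rightarrow> cvec \<Rightarrow> complex" where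
  "conv f n u v = (\<Sum>a=2..n - 2. f a * u a * v (n - a))"

lemma conv_flip: "conv f n u v = conv (\<lambda>a. f (n - a)) n v u"
  unfolding conv_def
  by (rule sum.reindex_bij_witness[of _ "\<lambda>a. n - a" "\<lambda>a. n - a"]) (auto simp: mult_ac)

lemma conv_cong:
  assumes "\<And>a. 2 \<le> a \<Longrightarrow> a \<le> n - 2 \<Longrightarrow> f a = g a"
  shows "conv f n u v = conv g n u v"
  using assms by (simp add: conv_def)

text \<open>Reflection maps the upper half \<open>m + 1, ..., 2 * m - 1\<close> onto
  \<open>2, ..., m\<close>; antisymmetry of \<open>f\<close> supplies the minus sign of the
  wedge.\<close>

lemma conv_antisym_odd:
  assumes "\<And>a. 2 \<le> a \<Longrightarrow> a \<le> 2 * m - 1 \<Longrightarrow> f (2 * m + 1 - a) = - f a"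
  shows "(\<Sum>j=2..m. f j * wedge (\<omega> j) (\<omega> (2 * m + 1 - j)) u v) = conv f (2 * m + 1) u v"
proof -
  have "{2..2 * m + 1 - 2} = {2..m} \<union> {m + 1..2 * m - 1}"
    by auto
  then have "conv f (2 * m + 1) u v = (\<Sum>j=2..m. f j * u j * v (2 * m + 1 - j))
      + (\<Sum>j=m + 1..2 * m - 1. f j * u j * v (2 * m + 1 - j))"
    unfolding conv_def by (simp add: sum.union_disjoint)
  also have "(\<Sum>j=m + 1..2 * m - 1. f j * u j * v (2 * m + 1 - j))
      = (\<Sum>j=2..m. - f j * u (2 * m + 1 - j) * v j)"
    by (rule sum.reindex_bij_witness[of _ "\<lambda>a. 2 * m + 1 - a" "\<lambda>a. 2 * m + 1 - a"])
      (auto simp: assms[simplified])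
  finally show ?thesis
    by (simp add: wedge_def \<omega>_def sum.distrib sum_negf sum_subtractf algebra_simps)
qed

text \<open>The same folding, except that \<open>m + 1\<close> is now its own mirror image, so
  antisymmetry forces its coefficient to vanish.\<close>

lemma conv_antisym_even:
  assumes "\<And>a. 2 \<le> a \<Longrightarrow> a \<le> 2 * m \<Longrightarrow> f (2 * m + 2 - a) = - f a"
  shows "(\<Sum>j=2..m. f j * wedge (\<omega> j) (\<omega> (2 * m + 2 - j)) u v) = conv f (2 * m + 2) u v"
proof (cases "m = 0")
  case False
  have mid: "f (m + 1) = 0"
    using assms[of "m + 1"] False by (simp add: eq_neg_iff_add_eq_0)
  from False have "{2..2 * m + 2 - 2} = insert (m + 1) ({2..m} \<union> {m + 2..2 * m})"
    by auto
  then have "conv f (2 * m + 2) u v = (\<Sum>j=2..m. f j * u j * v (2 * m + 2 - j))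
      + (\<Sum>j=m + 2..2 * m. f j * u j * v (2 * m + 2 - j))"
    unfolding conv_def using mid by (simp add: sum.union_disjoint)
  also have "(\<Sum>j=m + 2..2 * m. f j * u j * v (2 * m + 2 - j))
      = (\<Sum>j=2..m. - f j * u (2 * m + 2 - j) * v j)"
    by (rule sum.reindex_bij_witness[of _ "\<lambda>a. 2 * m + 2 - a" "\<lambda>a. 2 * m + 2 - a"])
      (auto simp: assms[simplified])
  finally show ?thesis
    by (simp add: wedge_def \<omega>_def sum.distrib sum_negf sum_subtractf algebra_simps)
qed (simp add: conv_def)

definition alt_coeff :: "nat \<Rightarrow> complex" where
  "alt_coeff a = (-1) ^ a"

text \<open>The difference is taken in the complex numbers: it agrees with
  \<open>of_nat (m + 1 - a)\<close> up to \<open>a = m + 1\<close> and is negative beyond, which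
  makes the coefficient antisymmetric under \<open>a\<close> to
  \<open>2 * m + 2 - a\<close>.\<close>

definition weighted_coeff :: "nat \<Rightarrow> nat \<Rightarrow> complex" where
  "weighted_coeff m a = (-1) ^ a * (of_nat m + 1 - of_nat a)"

lemma bracket_odd: "m \<ge> 4 \<Longrightarrow> bracket m u v (2 * m + 1) = conv alt_coeff (2 * m + 1) u v"
  by (subst conv_antisym_odd[symmetric])
    (auto simp: bracket_def d\<omega>_def alt_coeff_def minus_one_power_iff)

lemma bracket_even:
  assumes "m \<ge> 4"
  shows "bracket m u v (2 * m + 2) =
    u 1 * v (2 * m + 1) - v 1 * u (2 * m + 1) + conv (weighted_coeff m) (2 * m + 2) u v"
proof -
  have "(\<Sum>j=2..m. (-1) ^ j * of_nat (m + 1 - j) * wedge (\<omega> j) (\<omega> (2 * m + 2 - j)) u v)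
     = (\<Sum>j=2..m. weighted_coeff m j * wedge (\<omega> j) (\<omega> (2 * m + 2 - j)) u v)"
    by (rule sum.cong) (auto simp: weighted_coeff_def of_nat_diff)
  also have "\<dots> = conv (weighted_coeff m) (2 * m + 2) u v"
    by (rule conv_antisym_even)
      (auto simp: weighted_coeff_def of_nat_diff minus_one_power_iff algebra_simps)
  finally show ?thesis
    using assms by (simp add: bracket_def d\<omega>_def wedge_def \<omega>_def)
qed

lemma bracket_low:
  "3 \<le> l \<Longrightarrow> l \<le> 2 * m \<Longrightarrow> bracket m u v l = u 1 * v (l - 1) - v 1 * u (l - 1)"
  by (simp add: bracket_def d\<omega>_def wedge_def \<omega>_def)

lemma bracket_zero: "l < 3 \<or> l > 2 * m + 2 \<Longrightarrow> m \<ge> 4 \<Longrightarrow> bracket m u v l = 0"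
  by (auto simp: bracket_def d\<omega>_def)

text \<open>Here \<open>w\<close> stands for \<open>bracket m y z\<close>, whose low coordinates are
  index shifts by \<open>X 1\<close>; nesting it in a convolution lowers the total by one.\<close>

lemma conv_shift:
  assumes "n \<ge> 4" "w 2 = 0"
    "\<And>i. 3 \<le> i \<Longrightarrow> i \<le> n - 1 \<Longrightarrow> w i = y 1 * z (i - 1) - z 1 * y (i - 1)"
  shows "conv f (Suc n) x w = y 1 * conv f n x z - z 1 * conv f n x y"
proof -
  \<comment> \<open>The total \<open>Suc n\<close> allows one more index, \<open>n - 1\<close>,
    whose term contains \<open>w 2 = 0\<close>.\<close>
  have "conv f (Suc n) x w = (\<Sum>a\<in>insert (n - 1) {2..n - 2}. f a * x a * w (Suc n - a))"
    unfolding conv_def using assms(1) by (intro sum.cong) auto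
  also have "\<dots> = (\<Sum>a=2..n - 2. f a * x a * w (Suc n - a))"
  proof -
    have "n - 1 \<notin> {2..n - 2}" "Suc n - (n - 1) = 2"
      using assms(1) by auto
    with assms(2) show ?thesis
      by (subst sum.insert) simp_all
  qed
  also have "\<dots> = (\<Sum>a=2..n - 2. y 1 * (f a * x a * z (n - a)) - z 1 * (f a * x a * y (n - a)))"
  proof (rule sum.cong)
    fix a assume "a \<in> {2..n - 2}"
    then have w: "w (Suc n - a) = y 1 * z (n - a) - z 1 * y (n - a)"
      using assms(3)[of "Suc n - a"] assms(1) by (auto simp: Suc_diff_le)
    show "f a * x a * w (Suc n - a) = y 1 * (f a * x a * z (n - a)) - z 1 * (f a * x a * y (n - a))"
      unfolding w by (simp add: algebra_simps)
  qed simp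
  finally show ?thesis
    by (simp add: conv_def sum_distrib_left sum_subtractf)
qed

lemma conv_add_right: "conv f n x (v + w) = conv f n x v + conv f n x w"
  by (simp add: conv_def algebra_simps sum.distrib)

text \<open>Reflection in an even total preserves parity. This symmetry cancels the bracket terms of
  the Jacobi sum in coordinate \<open>2 * m + 1\<close>.\<close>

lemma conv_alt_commute: "conv alt_coeff (2 * m) u v = conv alt_coeff (2 * m) v u"
  by (subst conv_flip) (rule conv_cong, auto simp: alt_coeff_def minus_one_power_iff)

text \<open>Reflection in \<open>2 * m + 1\<close> lowers the weight by exactly
  \<open>alt_coeff a\<close>. In coordinate \<open>2 * m + 2\<close> this lets the
  \<open>X 1\<close> term of the outer bracket cancel against the weighted sums.\<close>

lemma conv_weighted_commutator:
  "conv (weighted_coeff m) (2 * m + 1) u v - conv (weighted_coeff m) (2 * m + 1) v u = conv alt_coeff (2 * m + 1) u v"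
proof -
  have "conv (weighted_coeff m) (2 * m + 1) v u = conv (\<lambda>a. weighted_coeff m (2 * m + 1 - a)) (2 * m + 1) u v"
    by (rule conv_flip)
  also have "\<dots> = conv (\<lambda>a. weighted_coeff m a - alt_coeff a) (2 * m + 1) u v"
    by (rule conv_cong)
      (auto simp: alt_coeff_def weighted_coeff_def of_nat_diff minus_one_power_iff algebra_simps)
  finally show ?thesis
    by (simp add: conv_def algebra_simps sum_subtractf)
qed

lemma bracket_bilinear: "bilinear_on (cspace (2 * m + 2)) (bracket m)"
  unfolding bilinear_on_def fun_eq_iff
  by (auto simp: cspace_def bracket_def d\<omega>_def wedge_def \<omega>_def scale_def algebra_simps
        sum.distrib sum_subtractf sum_distrib_left)

lemma psi_bar_bilinear:
  assumes "m \<ge> 4" "k \<le> 2 * m - 4"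
  shows "bilinear_on (cspace (2 * m + 2)) (psi_bar m k)"
  using assms unfolding bilinear_on_def fun_eq_iff
  by (auto simp: cspace_def psi_bar_apply scale_def algebra_simps)

lemma bilinear_on_add:
  assumes "bilinear_on (cspace n) b" "bilinear_on (cspace n) c"
  shows "bilinear_on (cspace n) (\<lambda>x y. b x y + c x y)"
proof -
  have "scale a (u + v) = scale a u + scale a v" for a u v
    by (simp add: scale_def algebra_simps fun_eq_iff)
  moreover have "u + v \<in> cspace n" if "u \<in> cspace n" "v \<in> cspace n" for u v
    using that by (simp add: cspace_def)
  ultimately show ?thesis
    using assms unfolding bilinear_on_def by (simp add: algebra_simps)
qed

section \<open>The Jacobi identity for small and for large \<open>k\<close>\<close>

lemma conv_X:
  assumes "2 \<le> i" "i \<le> n - 2"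
  shows "conv f n (X i) w = f i * w (n - i)"
proof -
  have "conv f n (X i) w = (\<Sum>a=2..n - 2. if a = i then f a * w (n - a) else 0)"
    unfolding conv_def by (rule sum.cong) (auto simp: X_def)
  then show ?thesis
    using assms by simp
qed

lemma conv_top:
  assumes "n \<ge> 5" "\<And>i. i < n - 3 \<Longrightarrow> w i = 0"
  shows "conv f n x w = f 2 * x 2 * w (n - 2) + f 3 * x 3 * w (n - 3)"
proof -
  have "{2..n - 2} = insert 2 (insert 3 {4..n - 2})"
    using assms(1) by auto
  moreover have "(\<Sum>a=4..n - 2. f a * x a * w (n - a)) = 0"
    by (rule sum.neutral) (auto simp: assms[simplified])
  ultimately show ?thesis
    by (simp add: conv_def)
qed

text \<open>The index \<open>j\<close> is chosen so that two values of the map reach the last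
  coordinate: \<open>X (k + 4)\<close>, from \<open>X 2\<close> and \<open>X 3\<close>, pairs with
  \<open>X j\<close>, and \<open>X (2 * m - 1)\<close>, from \<open>X 2\<close> and
  \<open>X j\<close>, pairs with \<open>X 3\<close>.\<close>

lemma jacobi_fails_of_small:
  assumes m: "m \<ge> 4" and k: "k + 6 \<le> 2 * m"
    and b_def: "b = (\<lambda>x y. bracket m x y + psi_bar m k x y)"
  defines "j \<equiv> 2 * m - 2 - k"
  shows "(b (X 2) (b (X 3) (X j)) + b (X 3) (b (X j) (X 2)) + b (X j) (b (X 2) (X 3))) (2 * m + 2) \<noteq> 0"
proof -
  have k': "k \<le> 2 * m - 4" and j: "4 \<le> j" "j \<le> 2 * m - 2" "2 * m + 2 - j = k + 4"
    using k by (auto simp: j_def)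
  have k2: "k + 4 \<le> 2 * m - 1"
    using k by linarith
  have low: "b x y l = x 1 * y (l - 1) - y 1 * x (l - 1) +
      (if k + 4 \<le> l then x 2 * y (l - 1 - k) - y 2 * x (l - 1 - k) else 0)"
    if "3 \<le> l" "l \<le> 2 * m" for x y l
    using that m k' by (simp add: b_def bracket_low psi_bar_apply)
  \<comment> \<open>For \<open>2 \<le> i\<close> there is no \<open>X 1\<close> term, and the map
    never reaches coordinate \<open>2 * m + 2\<close>, so a single convolution term remains.\<close>
  have top: "b (X i) w (2 * m + 2) = weighted_coeff m i * w (2 * m + 2 - i)"
    if "2 \<le> i" "i \<le> 2 * m" for i w
    using that m k' by (simp add: b_def bracket_even psi_bar_apply conv_X del: add_2_eq_Suc') (simp add: X_def)
  have "b (X 2) (b (X 3) (X j)) (2 * m + 2) = 0"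
    using m j by (simp add: top low del: add_2_eq_Suc') (simp add: X_def)
  moreover have "b (X 3) (b (X j) (X 2)) (2 * m + 2) = of_nat m - 2"
    using m j k k2 by (simp add: top low del: add_2_eq_Suc') (simp add: X_def weighted_coeff_def j_def)
  moreover have "b (X j) (b (X 2) (X 3)) (2 * m + 2) = (-1) ^ k * (of_nat k + 3 - of_nat m)"
    using m j k by (simp add: top low del: add_2_eq_Suc') (simp add: X_def weighted_coeff_def j_def minus_one_power_iff of_nat_diff)
  moreover have "of_nat m - 2 + (-1) ^ k * (of_nat k + 3 - of_nat m) \<noteq> (0::complex)"
  proof (cases "even k")
    case True
    have "of_nat (k + 1) \<noteq> (0::complex)"
      by (simp only: of_nat_eq_0_iff)
    with True show ?thesis
      by (simp add: add.commute)
  next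
    case False
    have "of_nat (2 * m - 5 - k) \<noteq> (0::complex)"
      using k by (simp only: of_nat_eq_0_iff)
    with False k show ?thesis
      by (simp add: of_nat_diff algebra_simps)
  qed
  ultimately show ?thesis
    by simp
qed

text \<open>In each coordinate \<open>b u (b v w)\<close> is brought to a closed form whose cyclic
  sum cancels; leftover terms are 3 by 3 determinants with a repeated row or in pairs of opposite
  sign.\<close>

lemma jacobi_holds_of_large:
  assumes m: "m \<ge> 4" and k: "k = 2 * m - 5 \<or> k = 2 * m - 4"
  defines "b \<equiv> (\<lambda>x y. bracket m x y + psi_bar m k x y)"
  shows "b x (b y z) + b y (b z x) + b z (b x y) = 0"
proof
  fix l
  have k': "k \<le> 2 * m - 4" "2 * m - 5 \<le> k"
    using k by auto
  have psi0: "psi_bar m k u v i = 0" if "i < 2 * m - 1" for u v i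
  proof -
    have "\<not> k + 4 \<le> i"
      using that k' by linarith
    then show ?thesis
      using k' m by (simp add: psi_bar_apply)
  qed
  have low: "b u v i = u 1 * v (i - 1) - v 1 * u (i - 1) + psi_bar m k u v i"
    if "3 \<le> i" "i \<le> 2 * m" for u v i
    using that by (simp add: b_def bracket_low)
  have zero: "b u v i = 0" if "i < 3 \<or> i > 2 * m + 2" for u v i
    using that m k' by (auto simp: b_def bracket_zero psi_bar_apply)
  have psi_zero: "psi_bar m k u v i = 0" if "i > 2 * m" for u v i
    using that m k' by (auto simp: psi_bar_apply)
  \<comment> \<open>The bracket part is shifted down to total \<open>n\<close>; the part from the
    map meets only \<open>u 2\<close> and \<open>u 3\<close>.\<close>
  have conv_b: "conv f (Suc n) u (b v w) = v 1 * conv f n u w - w 1 * conv f n u v +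
      f 2 * u 2 * psi_bar m k v w (n - 1) + f 3 * u 3 * psi_bar m k v w (n - 2)"
    if n: "n = 2 * m \<or> n = 2 * m + 1" for f n u v w
  proof -
    have "conv f (Suc n) u (bracket m v w) = v 1 * conv f n u w - w 1 * conv f n u v"
      by (rule conv_shift) (use n m in \<open>auto simp: bracket_low bracket_zero\<close>)
    moreover have "conv f (Suc n) u (psi_bar m k v w) =
        f 2 * u 2 * psi_bar m k v w (Suc n - 2) + f 3 * u 3 * psi_bar m k v w (Suc n - 3)"
      by (rule conv_top) (use n m in \<open>auto intro: psi0\<close>)
    ultimately show ?thesis
      using n m by (auto simp: b_def conv_add_right numeral_2_eq_2 numeral_3_eq_3)
  qed
  have psi_top: "psi_bar m k u v (2 * m) = u 2 * v (2 * m - 1 - k) - v 2 * u (2 * m - 1 - k)"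
      "psi_bar m k u v (2 * m - 1) = (if k = 2 * m - 5 then u 2 * v 3 - v 2 * u 3 else 0)" for u v
  proof -
    have k4: "k + 4 \<le> 2 * m"
      using m k' by linarith
    have idx: "2 * m - 1 - 1 - k = 3" "k + 4 \<le> 2 * m - 1" if "k = 2 * m - 5"
      using that m by linarith+
    show "psi_bar m k u v (2 * m) = u 2 * v (2 * m - 1 - k) - v 2 * u (2 * m - 1 - k)"
      using m k' k4 by (simp add: psi_bar_apply)
    show "psi_bar m k u v (2 * m - 1) = (if k = 2 * m - 5 then u 2 * v 3 - v 2 * u 3 else 0)"
    proof (cases "k = 2 * m - 5")
      case True
      with idx[OF True] m k' show ?thesis by (simp only: psi_bar_apply) simp
    next
      case False
      then have "\<not> k + 4 \<le> 2 * m - 1"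
        using k' by linarith
      with False m k' show ?thesis by (simp only: psi_bar_apply) simp
    qed
  qed
  consider "l < 3 \<or> l > 2 * m + 2" | "l = 3" | "4 \<le> l" "l \<le> 2 * m - 2" | "l = 2 * m - 1" | "l = 2 * m"
    | "l = 2 * m + 1" | "l = 2 * m + 2"
    by linarith
  then show "(b x (b y z) + b y (b z x) + b z (b x y)) l = 0 l"
  proof cases
    case 1
    then show ?thesis by (simp add: zero)
  next
    case 2
    then show ?thesis using m by (simp add: zero low psi0)
  next
    case 3
    then show ?thesis by (simp add: zero low psi0 algebra_simps)
  next
    case 4
    \<comment> \<open>The extra term exists only for \<open>k = 2 * m - 5\<close>, when the map
      reads coordinate 3 of \<open>b v w\<close>. Its cyclic sum is a determinant with the row of
      coordinate 2 repeated.\<close>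
    have "b u (b v w) l = u 1 * (v 1 * w (2 * m - 3) - w 1 * v (2 * m - 3))
        + (if k = 2 * m - 5 then u 2 * (v 1 * w 2 - w 1 * v 2) else 0)" for u v w
    proof -
      have "b v w 1 = 0" "b v w 2 = 0"
        by (simp_all add: zero)
      moreover have "b v w 3 = v 1 * w 2 - w 1 * v 2"
        using m by (simp add: low psi0)
      moreover have "2 * m - 2 - 1 = 2 * m - 3"
        by simp
      then have "b v w (2 * m - 2) = v 1 * w (2 * m - 3) - w 1 * v (2 * m - 3)"
        using m low[of "2 * m - 2"] psi0[of "2 * m - 2"] by simp
      moreover have "b u (b v w) l = u 1 * b v w (2 * m - 2) - b v w 1 * u (2 * m - 2)
          + psi_bar m k u (b v w) (2 * m - 1)"
        using 4 m low[of l u] by (simp add: numeral_2_eq_2)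
      ultimately show ?thesis
        by (simp add: psi_top(2) del: One_nat_def)
    qed
    then show ?thesis
      by (simp del: One_nat_def) (simp add: algebra_simps)
  next
    case 5
    have "b u (b v w) l = u 1 * (v 1 * w (2 * m - 2) - w 1 * v (2 * m - 2) + psi_bar m k v w (2 * m - 1))
        + u 2 * (v 1 * w (2 * m - 2 - k) - w 1 * v (2 * m - 2 - k))" for u v w
    proof -
      have "b v w 1 = 0" "b v w 2 = 0"
        by (simp_all add: zero)
      moreover have "b v w (2 * m - 1 - k) = v 1 * w (2 * m - 2 - k) - w 1 * v (2 * m - 2 - k)"
      proof -
        have "3 \<le> 2 * m - 1 - k" "2 * m - 1 - k < 2 * m - 1" "2 * m - 1 - k \<le> 2 * m" "2 * m - 1 - k - 1 = 2 * m - 2 - k"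
          using k' m by linarith+
        then show ?thesis
          using low[of "2 * m - 1 - k" v w] psi0[of "2 * m - 1 - k" v w] by (simp del: diff_diff_left)
      qed
      moreover have "2 * m - 1 - 1 = 2 * m - 2"
        by simp
      then have "b v w (2 * m - 1) = v 1 * w (2 * m - 2) - w 1 * v (2 * m - 2) + psi_bar m k v w (2 * m - 1)"
        using m low[of "2 * m - 1"] by simp
      moreover have "b u (b v w) l = u 1 * b v w (2 * m - 1) - b v w 1 * u (2 * m - 1)
          + psi_bar m k u (b v w) (2 * m)"
        using 5 m low[of l u] by simp
      ultimately show ?thesis
        by (simp add: psi_top(1) del: One_nat_def)
    qed
    \<comment> \<open>For index 3 the two extra terms are determinants in coordinates 1, 2, 3 of
      opposite sign; for index 2 the first is zero and the second repeats a row.\<close>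
    moreover have "2 * m - 2 - k = (if k = 2 * m - 5 then 3 else 2)"
      using k m by auto
    ultimately show ?thesis
      by (simp add: psi_top(2) del: One_nat_def) (simp add: algebra_simps)
  next
    case 6
    have "b u (b v w) l = v 1 * conv alt_coeff (2 * m) u w - w 1 * conv alt_coeff (2 * m) u v +
       u 2 * psi_bar m k v w (2 * m - 1)" for u v w
      using 6 m conv_b[of "2 * m" alt_coeff] by (simp add: bracket_odd[simplified] psi_zero psi0 b_def alt_coeff_def)
    then show ?thesis
      by (simp only: plus_fun_apply psi_top conv_alt_commute[of m y x] conv_alt_commute[of m z y] conv_alt_commute[of m z x])
        (simp add: algebra_simps)
  next
    case 7
    have "b v w (2 * m + 1) = conv alt_coeff (2 * m + 1) v w" for v w
      using m by (simp add: b_def psi_zero bracket_odd[simplified])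
    then have "b u (b v w) l = u 1 * (conv (weighted_coeff m) (2 * m + 1) v w - conv (weighted_coeff m) (2 * m + 1) w v)
       + v 1 * conv (weighted_coeff m) (2 * m + 1) u w - w 1 * conv (weighted_coeff m) (2 * m + 1) u v +
       weighted_coeff m 2 * u 2 * psi_bar m k v w (2 * m) + weighted_coeff m 3 * u 3 * psi_bar m k v w (2 * m - 1)" for u v w
      using 7 m conv_b[of "2 * m + 1" "weighted_coeff m" u v w] zero[of 1]
      by (simp add: b_def bracket_even[simplified] psi_zero conv_weighted_commutator[simplified])
    \<comment> \<open>The convolutions cancel for each of \<open>x 1\<close>, \<open>y 1\<close>,
      \<open>z 1\<close> separately. The terms with \<open>u 2\<close> and \<open>u 3\<close> repeat
      a row each, so their cyclic sums vanish whatever the weights.\<close>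
    then show ?thesis
      by (simp only: plus_fun_apply psi_top) (simp add: algebra_simps)
  qed
qed

theorem mainTheorem4:
  fixes m k :: nat
  assumes "m \<ge> 4" and "k \<le> 2 * m - 4"
  shows "linearly_expandable_on (cspace (2 * m + 2)) (bracket m) (psi_bar m k) \<longleftrightarrow>
           k = 2 * m - 5 \<or> k = 2 * m - 4"
proof
  assume L: "linearly_expandable_on (cspace (2 * m + 2)) (bracket m) (psi_bar m k)"
  show "k = 2 * m - 5 \<or> k = 2 * m - 4"
  proof (rule ccontr)
    assume "\<not> ?thesis"
    then have k: "k + 6 \<le> 2 * m"
      using assms by linarith
    have mem: "X i \<in> cspace (2 * m + 2)" if "1 \<le> i" "i \<le> 2 * m + 2" for i
      using that by (auto simp: cspace_def X_def)
    have "X 2 \<in> cspace (2 * m + 2)" "X 3 \<in> cspace (2 * m + 2)"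
        "X (2 * m - 2 - k) \<in> cspace (2 * m + 2)"
      by (rule mem; use assms(1) k in linarith)+
    moreover define b where "b = (\<lambda>x y. bracket m x y + psi_bar m k x y)"
    ultimately have "b (X 2) (b (X 3) (X (2 * m - 2 - k))) + b (X 3) (b (X (2 * m - 2 - k)) (X 2))
        + b (X (2 * m - 2 - k)) (b (X 2) (X 3)) = 0"
      using L unfolding linearly_expandable_on_def lie_bracket_on_def b_def[symmetric] by blast
    with jacobi_fails_of_small[OF assms(1) k b_def] show False
      by (simp only: zero_fun_apply not_True_eq_False simp_thms)
  qed
next
  assume k: "k = 2 * m - 5 \<or> k = 2 * m - 4"
  have "bracket m x x + psi_bar m k x x = 0" for x
    using assms by (simp add: fun_eq_iff psi_bar_apply bracket_def d\<omega>_def wedge_def)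
  moreover have "bilinear_on (cspace (2 * m + 2)) (\<lambda>x y. bracket m x y + psi_bar m k x y)"
    using assms by (intro bilinear_on_add bracket_bilinear psi_bar_bilinear)
  ultimately show "linearly_expandable_on (cspace (2 * m + 2)) (bracket m) (psi_bar m k)"
    using jacobi_holds_of_large[OF assms(1) k]
    unfolding linearly_expandable_on_def lie_bracket_on_def
    by blast
qed

end
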